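(* Let $\epsilon>0$. There exist constants $C_\epsilon>0$ and $n_0$ such that the following holds for all $n\ge n_0$, all integers $m\ge(1+\epsilon)n$ and all $\ell>0$. Let $R=\{r_1,\ldots,r_n\}$ and $D=\{d_1,\ldots,d_m\}$ be independent uniform random points on $[0,\ell]$. Suppose the riders are revealed one at a time in an order chosen by an adversary who knows all positions of riders and drivers and the full state of the algorithm, and consider the greedy algorithm which, when a rider $r$ is revealed, irrevocably matches $r$ to the closest currently unmatched driver. Let $cost(Greedy)=\sum |r-d|$ over the matched pairs $(r,d)$. Then $\mathbb{E}[cost(Greedy)]\le C_\epsilon\,\ell\log^3(n)$, where the expectation is over the randomness of $R$ and $D$.
   Context: Drivers are all present at the start; each rider must be matched on arrival to an unmatched driver (there are always enough drivers since $m\ge n$). $\log$ is the natural logarithm. *)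

theory Defs
  imports "HOL-Probability.Probability"
begin

text \<open>
  Riders are indexed by \<open>{..<n}\<close> and drivers by \<open>{..<m}\<close>; an outcome is the pair \<open>(r, d)\<close> of
  their position vectors.  The state of the online process is the list of matched
  (rider, driver) pairs so far, most recent first.
\<close>

type_synonym positions = "(nat \<Rightarrow> real) \<times> (nat \<Rightarrow> real)"
type_synonym state = "(nat \<times> nat) list"

text \<open>An adversary sees all positions and the current state and names the next rider.\<close>

type_synonym adversary = "positions \<Rightarrow> state \<Rightarrow> nat"

definition instance_space :: "nat \<Rightarrow> nat \<Rightarrow> real \<Rightarrow> positions measure" where
  "instance_space n m l =
     (\<Pi>\<^sub>M i\<in>{..<n}. uniform_measure lborel {0..l}) \<Otimes>\<^sub>M
     (\<Pi>\<^sub>M j\<in>{..<m}. uniform_measure lborel {0..l})"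

definition unrevealed :: "nat \<Rightarrow> state \<Rightarrow> nat set" where
  "unrevealed n h = {..<n} - fst ` set h"

definition unmatched :: "nat \<Rightarrow> state \<Rightarrow> nat set" where
  "unmatched m h = {..<m} - snd ` set h"

text \<open>
  Measurability in the positions is what makes the expected cost meaningful.  It does not weaken
  the adversary: there are finitely many orders, so a pointwise worst one can be chosen measurably.
\<close>

definition valid_adversary :: "nat \<Rightarrow> nat \<Rightarrow> real \<Rightarrow> adversary \<Rightarrow> bool" where
  "valid_adversary n m l A \<longleftrightarrow>
     (\<forall>h. (\<lambda>p. A p h) \<in> instance_space n m l \<rightarrow>\<^sub>M count_space UNIV) \<and>
     (\<forall>p \<in> space (instance_space n m l). \<forall>h.
        unrevealed n h \<noteq> {} \<longrightarrow> A p h \<in> unrevealed n h)"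

text \<open>Equidistant closest drivers (a null event) are resolved by the choice in \<^const>\<open>arg_min_on\<close>.\<close>

definition closest_unmatched :: "nat \<Rightarrow> (nat \<Rightarrow> real) \<Rightarrow> state \<Rightarrow> real \<Rightarrow> nat" where
  "closest_unmatched m d h x = arg_min_on (\<lambda>j. \<bar>x - d j\<bar>) (unmatched m h)"

primrec greedy_run :: "nat \<Rightarrow> adversary \<Rightarrow> positions \<Rightarrow> nat \<Rightarrow> state" where
  "greedy_run m A p 0 = []"
| "greedy_run m A p (Suc k) =
     (let h = greedy_run m A p k; i = A p h
      in (i, closest_unmatched m (snd p) h (fst p i)) # h)"

definition greedy_cost :: "nat \<Rightarrow> nat \<Rightarrow> adversary \<Rightarrow> positions \<Rightarrow> real" where
  "greedy_cost n m A p = (\<Sum>(i, j)\<leftarrow>greedy_run m A p n. \<bar>fst p i - snd p j\<bar>)"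

end

theory Submission
  imports Defs
begin

text \<open>
  A rider never jumps over an unmatched driver.  Hence, if \<open>a < b\<close> are the unmatched drivers next to a
  newly revealed rider, all drivers in \<open>(a, b)\<close> are matched to riders in \<open>[a, b]\<close>, so this gap
  contains at most as many drivers as riders.  As drivers outnumber riders by a factor \<open>1 + \<epsilon>\<close>, a
  Chernoff bound with exponential weight \<open>u = sqrt (1 + \<epsilon>)\<close> and a union bound over a grid with \<open>n\<close>
  cells show that with probability \<open>1 - O(1/n)\<close> no such gap is longer than \<open>O(l log n / n)\<close>.  Every one
  of the \<open>n\<close> matches is then at most that long; the exceptional event contributes at most \<open>n l O(1/n)\<close>.
  This gives the bound \<open>O(l log n)\<close>.
\<close>

section \<open>Measurability of the run and its cost\<close>

text \<open>The set of minimisers takes finitely many values, each on an event described by finitely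
  many comparisons. The choice made by \<open>arg_min_on\<close> depends on that set alone, and
  every function on a count space is measurable, so the way ties are broken does no harm.\<close>

lemma arg_min_on_measurable:
  fixes f :: "'a \<Rightarrow> 'b \<Rightarrow> real"
  assumes "finite S" and [measurable]: "\<And>j. j \<in> S \<Longrightarrow> (\<lambda>p. f p j) \<in> borel_measurable M"
  shows "(\<lambda>p. arg_min_on (f p) S) \<in> M \<rightarrow>\<^sub>M count_space UNIV"
proof -
  let ?m = "\<lambda>p. {j \<in> S. \<forall>y\<in>S. \<not> f p y < f p j}"
  have "?m \<in> M \<rightarrow>\<^sub>M count_space (Pow S)"
  proof (subst measurable_count_space_eq2)
    show "finite (Pow S)" using assms by simp
    have "?m -` {T} \<inter> space M \<in> sets M" if "T \<subseteq> S" for T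
    proof -
      have [measurable]: "Measurable.pred M (\<lambda>p. \<not> f p y < f p j)" if "y \<in> S" "j \<in> S" for y j
        using that by measurable
      have "?m -` {T} \<inter> space M
          = {p \<in> space M. \<forall>j\<in>S. j \<in> T \<longleftrightarrow> (\<forall>y\<in>S. \<not> f p y < f p j)}"
        using that by auto
      also have "\<dots> \<in> sets M"
        using \<open>finite S\<close> by measurable
      finally show ?thesis .
    qed
    then show "?m \<in> space M \<rightarrow> Pow S \<and> (\<forall>T\<in>Pow S. ?m -` {T} \<inter> space M \<in> sets M)"
      by auto
  qed
  then have "(\<lambda>p. SOME j. j \<in> ?m p) \<in> M \<rightarrow>\<^sub>M count_space UNIV"
    by (rule measurable_compose) simp
  then show ?thesis
    by (simp add: arg_min_on_def arg_min_def is_arg_min_def Ball_def)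
qed

text \<open>Points of a product space are extensional, so a coordinate outside the index range is
  the constant \<open>undefined\<close>. This makes the statement available for every index that may
  occur in an arbitrary state.\<close>

lemma coordinate_measurable:
  "(\<lambda>p. fst p i) \<in> borel_measurable (instance_space n m l)"
  "(\<lambda>p. snd p j) \<in> borel_measurable (instance_space n m l)"
proof -
  have coord: "(\<lambda>x. x i) \<in> borel_measurable (\<Pi>\<^sub>M i\<in>{..<k}. uniform_measure lborel {0..l})"
    if "i < k" for i k :: nat
  proof -
    have "(\<lambda>x. x i) \<in> (\<Pi>\<^sub>M i\<in>{..<k}. uniform_measure lborel {0..l}) \<rightarrow>\<^sub>M uniform_measure lborel {0..l}"
      using that by (intro measurable_component_singleton) simp
    then show ?thesis by (simp cong: measurable_cong_sets)
  qed
  show "(\<lambda>p. fst p i) \<in> borel_measurable (instance_space n m l)"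
  proof (cases "i < n")
    case True
    show ?thesis unfolding instance_space_def
      by (rule measurable_compose[OF measurable_fst coord[OF True]])
  next
    case False
    have "fst p i = undefined" if "p \<in> space (instance_space n m l)" for p
      using that False by (auto simp: instance_space_def space_pair_measure space_PiM PiE_def extensional_def)
    then show ?thesis by (subst measurable_cong[where g = "\<lambda>_. undefined"]) auto
  qed
  show "(\<lambda>p. snd p j) \<in> borel_measurable (instance_space n m l)"
  proof (cases "j < m")
    case True
    show ?thesis unfolding instance_space_def
      by (rule measurable_compose[OF measurable_snd coord[OF True]])
  next
    case False
    have "snd p j = undefined" if "p \<in> space (instance_space n m l)" for p
      using that False by (auto simp: instance_space_def space_pair_measure space_PiM PiE_def extensional_def)
    then show ?thesis by (subst measurable_cong[where g = "\<lambda>_. undefined"]) auto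
  qed
qed

lemma greedy_run_measurable:
  assumes "valid_adversary n m l A"
  shows "(\<lambda>p. greedy_run m A p k) \<in> instance_space n m l \<rightarrow>\<^sub>M count_space UNIV"
proof (induction k)
  case 0
  then show ?case by simp
next
  case (Suc k)
  note [measurable] = coordinate_measurable
  have A [measurable]: "(\<lambda>p. A p h) \<in> instance_space n m l \<rightarrow>\<^sub>M count_space UNIV" for h
    using assms by (simp add: valid_adversary_def)
  have step: "(\<lambda>p. (i, closest_unmatched m (snd p) h (fst p i)) # h)
      \<in> instance_space n m l \<rightarrow>\<^sub>M count_space UNIV" for i h
  proof -
    have "(\<lambda>p. closest_unmatched m (snd p) h (fst p i)) \<in> instance_space n m l \<rightarrow>\<^sub>M count_space UNIV"
      unfolding closest_unmatched_def
      by (rule arg_min_on_measurable) (auto simp: unmatched_def)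
    then show ?thesis by (rule measurable_compose) simp
  qed
  \<comment> \<open>The rider index and then the state are themselves random. Both range over
    countable types, so it suffices to fix their values and treat each case separately.\<close>
  have "(\<lambda>p. (A p h, closest_unmatched m (snd p) h (fst p (A p h))) # h)
      \<in> instance_space n m l \<rightarrow>\<^sub>M count_space UNIV" for h
    by (rule measurable_compose_countable[where f = "\<lambda>i p. (i, closest_unmatched m (snd p) h (fst p i)) # h"])
      (rule step A)+
  then have "(\<lambda>p. (\<lambda>h p. (A p h, closest_unmatched m (snd p) h (fst p (A p h))) # h) (greedy_run m A p k) p)
      \<in> instance_space n m l \<rightarrow>\<^sub>M count_space UNIV"
    by (rule measurable_compose_countable[where f = "\<lambda>h p. (A p h, closest_unmatched m (snd p) h (fst p (A p h))) # h"])
      (rule Suc.IH)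
  then show ?case
    by (simp only: greedy_run.simps Let_def)
qed

lemma greedy_cost_measurable:
  assumes "valid_adversary n m l A"
  shows "greedy_cost n m A \<in> borel_measurable (instance_space n m l)"
proof -
  note [measurable] = coordinate_measurable
  have "(\<lambda>p. \<Sum>(i, j)\<leftarrow>h. \<bar>fst p i - snd p j\<bar>) \<in> borel_measurable (instance_space n m l)" for h
    by (induction h) auto
  then have "(\<lambda>p. (\<lambda>h p. \<Sum>(i, j)\<leftarrow>h. \<bar>fst p i - snd p j\<bar>) (greedy_run m A p n) p)
      \<in> borel_measurable (instance_space n m l)"
    by (rule measurable_compose_countable) (rule greedy_run_measurable[OF assms])
  then show ?thesis
    by (simp add: greedy_cost_def[abs_def])
qed

section \<open>Invariant of the greedy run\<close>

text \<open>Each pair is compared only with drivers that are still unmatched in \<open>h\<close>,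
  not with all that were free when the pair was formed. Free drivers only become fewer, so this
  weaker condition survives later steps, and it is all that the gap argument uses.\<close>

definition greedy_matching :: "nat \<Rightarrow> nat \<Rightarrow> positions \<Rightarrow> state \<Rightarrow> bool" where
  "greedy_matching n m p h \<longleftrightarrow>
     distinct (map fst h) \<and> distinct (map snd h) \<and> set h \<subseteq> {..<n} \<times> {..<m} \<and>
     (\<forall>(i, j) \<in> set h. \<forall>j' \<in> unmatched m h. \<bar>fst p i - snd p j\<bar> \<le> \<bar>fst p i - snd p j'\<bar>)"

lemma closest_unmatched:
  assumes "unmatched m h \<noteq> {}"
  shows "closest_unmatched m d h x \<in> unmatched m h"
    and "j \<in> unmatched m h \<Longrightarrow> \<bar>x - d (closest_unmatched m d h x)\<bar> \<le> \<bar>x - d j\<bar>"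
proof -
  have fin: "finite (unmatched m h)" by (simp add: unmatched_def)
  show "closest_unmatched m d h x \<in> unmatched m h"
    unfolding closest_unmatched_def by (rule arg_min_if_finite(1)[OF fin assms])
  show "j \<in> unmatched m h \<Longrightarrow> \<bar>x - d (closest_unmatched m d h x)\<bar> \<le> \<bar>x - d j\<bar>"
    unfolding closest_unmatched_def by (rule arg_min_least[OF fin assms])
qed

lemma length_greedy_run: "length (greedy_run m A p k) = k"
  by (induction k) (auto simp: Let_def)

lemma unmatched_nonempty:
  assumes "length h < m"
  shows "unmatched m h \<noteq> {}"
proof
  assume "unmatched m h = {}"
  then have "{..<m} \<subseteq> snd ` set h" by (auto simp: unmatched_def)
  then have "m \<le> card (snd ` set h)" by (metis card_lessThan card_mono finite_imageI List.finite_set)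
  also have "\<dots> \<le> length h" by (metis card_length length_map set_map)
  finally show False using assms by simp
qed

lemma unrevealed_nonempty:
  assumes "length h < n"
  shows "unrevealed n h \<noteq> {}"
proof
  assume "unrevealed n h = {}"
  then have "{..<n} \<subseteq> fst ` set h" by (auto simp: unrevealed_def)
  then have "n \<le> card (fst ` set h)" by (metis card_lessThan card_mono finite_imageI List.finite_set)
  also have "\<dots> \<le> length h" by (metis card_length length_map set_map)
  finally show False using assms by simp
qed

lemma greedy_matching_greedy_run:
  assumes "valid_adversary n m l A" "p \<in> space (instance_space n m l)" "n \<le> m" "k \<le> n"
  shows "greedy_matching n m p (greedy_run m A p k)"
  using \<open>k \<le> n\<close>
proof (induction k)
  case 0
  then show ?case by (simp add: greedy_matching_def)
next
  case (Suc k)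
  let ?h = "greedy_run m A p k"
  let ?i = "A p ?h"
  let ?j = "closest_unmatched m (snd p) ?h (fst p ?i)"
  have IH: "greedy_matching n m p ?h" using Suc by simp
  have i: "?i \<in> unrevealed n ?h"
    using assms Suc.prems unrevealed_nonempty[of ?h n]
    by (auto simp: valid_adversary_def length_greedy_run)
  have ne: "unmatched m ?h \<noteq> {}"
    using unmatched_nonempty[of ?h m] assms Suc.prems by (simp add: length_greedy_run)
  note j = closest_unmatched[OF ne, where d = "snd p" and x = "fst p ?i"]
  have sub: "unmatched m ((?i, ?j) # ?h) \<subseteq> unmatched m ?h"
    by (auto simp: unmatched_def)
  have "\<bar>fst p i - snd p j\<bar> \<le> \<bar>fst p i - snd p j'\<bar>"
    if "(i, j) \<in> set ((?i, ?j) # ?h)" "j' \<in> unmatched m ((?i, ?j) # ?h)" for i j j'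
  proof (cases "(i, j) \<in> set ?h")
    case True
    then show ?thesis using IH that(2) sub unfolding greedy_matching_def by blast
  next
    case False
    then show ?thesis using that j(2)[of j'] sub by auto
  qed
  moreover have "?i < n" "?i \<notin> fst ` set ?h" "?j < m" "?j \<notin> snd ` set ?h"
    using i j(1) by (simp_all add: unrevealed_def unmatched_def)
  ultimately have "greedy_matching n m p ((?i, ?j) # ?h)"
    using IH unfolding greedy_matching_def by auto
  then show ?case by (simp add: Let_def)
qed

section \<open>The gap between neighbouring unmatched drivers\<close>

text \<open>Mapping each driver in the open gap to its rider gives an injection into the riders of
  the closed gap. The gap is open for drivers because those at its ends may be unmatched. It belongs
  to the state before a rider at \<open>x\<close> is served.\<close>

lemma gap_around_point:
  assumes h: "greedy_matching n m p h" and ne: "unmatched m h \<noteq> {}"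
    and r: "\<And>i. i < n \<Longrightarrow> fst p i \<in> {0..l}" and d: "\<And>j. j < m \<Longrightarrow> snd p j \<in> {0..l}"
    and x: "x \<in> {0..l}"
  obtains a b where "0 \<le> a" "a \<le> b" "b \<le> l"
    "\<bar>x - snd p (closest_unmatched m (snd p) h x)\<bar> \<le> b - a"
    "card {j. j < m \<and> snd p j \<in> {a<..<b}} \<le> card {i. i < n \<and> fst p i \<in> {a..b}}"
proof -
  let ?U = "unmatched m h"
  define L where "L = snd p ` {j \<in> ?U. snd p j \<le> x}"
  define R where "R = snd p ` {j \<in> ?U. x \<le> snd p j}"
  have fin: "finite ?U" and Um: "\<And>j. j \<in> ?U \<Longrightarrow> j < m" by (auto simp: unmatched_def)
  have finL: "finite L" and finR: "finite R" using fin by (auto simp: L_def R_def)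
  have L: "\<exists>j\<in>?U. y = snd p j \<and> 0 \<le> y \<and> y \<le> x" if "y \<in> L" for y
    using that d Um by (auto simp: L_def)
  have R: "\<exists>j\<in>?U. y = snd p j \<and> x \<le> y \<and> y \<le> l" if "y \<in> R" for y
    using that d Um by (auto simp: R_def)
  have LR: "snd p j \<in> L \<or> snd p j \<in> R" if "j \<in> ?U" for j
    using that by (cases "snd p j \<le> x") (auto simp: L_def R_def)
  \<comment> \<open>Without an unmatched driver on one side, the end of the segment takes its place.
    No rider lies beyond it, so the exchange argument below is needed only when the end is a true
    unmatched driver.\<close>
  define a where "a = (if L = {} then 0 else Max L)"
  define b where "b = (if R = {} then l else Min R)"
  have aL: "a \<in> L" if "L \<noteq> {}" using Max_in[OF finL that] that by (simp add: a_def)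
  have bR: "b \<in> R" if "R \<noteq> {}" using Min_in[OF finR that] that by (simp add: b_def)
  have a_ge: "y \<le> a" if "y \<in> L" for y using that Max_ge[OF finL that] by (auto simp: a_def)
  have b_le: "b \<le> y" if "y \<in> R" for y using that Min_le[OF finR that] by (auto simp: b_def)
  have a: "0 \<le> a" "a \<le> x"
    using aL L[of a] x by (cases "L = {}"; auto simp: a_def)+
  have b: "x \<le> b" "b \<le> l"
    using bR R[of b] x by (cases "R = {}"; auto simp: b_def)+
  have dist: "\<bar>x - snd p (closest_unmatched m (snd p) h x)\<bar> \<le> b - a"
  proof -
    \<comment> \<open>At least one end of the gap is an unmatched driver, and \<open>x\<close> lies
      in the gap, so the closest driver is at most \<open>b - a\<close> away.\<close>
    obtain j where j: "j \<in> ?U" using ne by auto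
    then have "L \<noteq> {} \<or> R \<noteq> {}" using LR by blast
    then obtain j where "j \<in> ?U" "snd p j = a \<or> snd p j = b"
      using aL bR L[of a] R[of b] by metis
    then show ?thesis
      using closest_unmatched(2)[OF ne, of j x "snd p"] a b by auto
  qed
  have partner: "\<exists>i. (i, j) \<in> set h \<and> i < n \<and> fst p i \<in> {a..b}"
    if j: "j < m" "snd p j \<in> {a<..<b}" for j
  proof -
    have "j \<notin> ?U"
    proof
      assume "j \<in> ?U"
      then show False using LR a_ge b_le j(2) by force
    qed
    then obtain i where i: "(i, j) \<in> set h" using j(1) by (auto simp: unmatched_def)
    then have "i < n" using h by (auto simp: greedy_matching_def)
    have close: "\<bar>fst p i - snd p j\<bar> \<le> \<bar>fst p i - snd p j'\<bar>" if "j' \<in> ?U" for j'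
      using h i that by (force simp: greedy_matching_def)
    have "a \<le> fst p i"
    proof (rule ccontr)
      \<comment> \<open>A rider left of \<open>a\<close> would have the unmatched driver at
        \<open>a\<close> strictly between itself and its partner, hence strictly closer.\<close>
      assume c: "\<not> a \<le> fst p i"
      then have "L \<noteq> {}" using r[OF \<open>i < n\<close>] by (auto simp: a_def split: if_splits)
      then obtain j' where "j' \<in> ?U" "snd p j' = a" using aL L[of a] by auto
      then show False using close[of j'] c j(2) by auto
    qed
    moreover have "fst p i \<le> b"
    proof (rule ccontr)
      assume c: "\<not> fst p i \<le> b"
      then have "R \<noteq> {}" using r[OF \<open>i < n\<close>] by (auto simp: b_def split: if_splits)
      then obtain j' where "j' \<in> ?U" "snd p j' = b" using bR R[of b] by auto
      then show False using close[of j'] c j(2) by auto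
    qed
    ultimately show ?thesis using i \<open>i < n\<close> by auto
  qed
  then obtain \<pi> where \<pi>: "\<And>j. j < m \<Longrightarrow> snd p j \<in> {a<..<b} \<Longrightarrow>
      (\<pi> j, j) \<in> set h \<and> \<pi> j < n \<and> fst p (\<pi> j) \<in> {a..b}"
    by metis
  have inj: "inj_on \<pi> {j. j < m \<and> snd p j \<in> {a<..<b}}"
  proof (rule inj_onI)
    fix j j' assume "j \<in> {j. j < m \<and> snd p j \<in> {a<..<b}}" "j' \<in> {j. j < m \<and> snd p j \<in> {a<..<b}}"
      and eq: "\<pi> j = \<pi> j'"
    then have "(\<pi> j, j) \<in> set h" "(\<pi> j, j') \<in> set h" using \<pi>[of j] \<pi>[of j'] by auto
    then show "j = j'" using h by (auto simp: greedy_matching_def intro: eq_key_imp_eq_value)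
  qed
  have "card {j. j < m \<and> snd p j \<in> {a<..<b}} \<le> card {i. i < n \<and> fst p i \<in> {a..b}}"
    by (rule card_inj_on_le[OF inj]) (use \<pi> in auto)
  then show ?thesis using that[of a b] a b dist by simp
qed

section \<open>The probability space of instances\<close>

lemma prob_space_uniform_interval:
  "l > 0 \<Longrightarrow> prob_space (uniform_measure lborel {0..l::real})"
  by (rule prob_space_uniform_measure) auto

lemma prob_space_instance_space:
  assumes "l > 0"
  shows "prob_space (instance_space n m l)"
proof -
  interpret U: prob_space "uniform_measure lborel {0..l}"
    using assms by (rule prob_space_uniform_interval)
  have *: "prob_space (\<Pi>\<^sub>M i\<in>I. uniform_measure lborel {0..l})" for I :: "nat set"
    by (rule prob_space_PiM) (rule U.prob_space_axioms)
  show ?thesis unfolding instance_space_def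
    by (intro prob_space_pair *)
qed

text \<open>The space of \<open>uniform_measure lborel {0..l}\<close> is the whole real line, so the
  positions lie in the segment only almost everywhere.\<close>

lemma AE_instance_space:
  assumes "l > 0"
  shows "AE p in instance_space n m l. (\<forall>i<n. fst p i \<in> {0..l}) \<and> (\<forall>j<m. snd p j \<in> {0..l})"
proof -
  let ?U = "uniform_measure lborel {0..l}"
  interpret U: prob_space ?U
    using assms by (rule prob_space_uniform_interval)
  have prob: "prob_space (\<Pi>\<^sub>M i\<in>I. ?U)" for I :: "nat set"
    by (rule prob_space_PiM) (rule U.prob_space_axioms)
  interpret P: pair_prob_space "\<Pi>\<^sub>M i\<in>{..<n}. ?U" "\<Pi>\<^sub>M j\<in>{..<m}. ?U"
    by (simp add: pair_prob_space_def pair_sigma_finite_def prob prob_space_imp_sigma_finite)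
  have U: "AE x in ?U. x \<in> {0..l}"
    by (rule AE_uniform_measureI) auto
  have "AE x in (\<Pi>\<^sub>M i\<in>{..<k}. ?U). x i \<in> {0..l}" if "i < k" for i k :: nat
    using that by (intro AE_PiM_component[where P = "\<lambda>x. x \<in> {0..l}"] U U.prob_space_axioms) auto
  then have *: "AE x in (\<Pi>\<^sub>M i\<in>{..<k}. ?U). \<forall>i<k. x i \<in> {0..l}" for k :: nat
    by (simp add: AE_all_countable)
  note [measurable] = coordinate_measurable[unfolded instance_space_def]
  show ?thesis unfolding instance_space_def
  proof (rule P.AE_pair_measure)
    show "{x \<in> space (Pi\<^sub>M {..<n} (\<lambda>i. ?U) \<Otimes>\<^sub>M Pi\<^sub>M {..<m} (\<lambda>j. ?U)).
        (\<forall>i<n. fst x i \<in> {0..l}) \<and> (\<forall>j<m. snd x j \<in> {0..l})}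
        \<in> sets (Pi\<^sub>M {..<n} (\<lambda>i. ?U) \<Otimes>\<^sub>M Pi\<^sub>M {..<m} (\<lambda>j. ?U))"
      by measurable
    show "AE x in Pi\<^sub>M {..<n} (\<lambda>i. ?U). AE y in Pi\<^sub>M {..<m} (\<lambda>j. ?U).
        (\<forall>i<n. fst (x, y) i \<in> {0..l}) \<and> (\<forall>j<m. snd (x, y) j \<in> {0..l})"
      using *[of n]
    proof eventually_elim
      case (elim x)
      show ?case using *[of m] by eventually_elim (use elim in auto)
    qed
  qed
qed

section \<open>Chernoff bound for comparing two counts\<close>

lemma prod_if_eq_power_card:
  "(\<Prod>i<n::nat. if P i then c else 1) = (c::'a::comm_monoid_mult) ^ card {i. i < n \<and> P i}"
proof -
  have "(\<Prod>i<n. if P i then c else 1) = (\<Prod>i\<in>{i\<in>{..<n}. P i}. c)"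
    by (rule prod.inter_filter[symmetric]) simp
  then show ?thesis by simp
qed

text \<open>The product is \<open>u\<close> to the power of riders minus drivers. In this form the
  comparison of counts is visibly measurable, and the weight factorises over the independent
  points.\<close>

lemma counts_le_iff_product:
  fixes n m :: nat and u :: real
  assumes "u > 1"
  shows "card {j. j < m \<and> d j \<in> T} \<le> card {i. i < n \<and> r i \<in> S} \<longleftrightarrow>
    1 \<le> (\<Prod>i<n. if r i \<in> S then u else 1) * (\<Prod>j<m. if d j \<in> T then 1 / u else 1)"
  using assms by (simp add: prod_if_eq_power_card power_one_over field_simps)

lemma counts_le_sets:
  assumes "S \<in> sets borel" "T \<in> sets borel"
  shows "{p \<in> space (instance_space n m l).
      card {j. j < m \<and> snd p j \<in> T} \<le> card {i. i < n \<and> fst p i \<in> S}} \<in> sets (instance_space n m l)"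
proof -
  note [measurable] = assms coordinate_measurable
  show ?thesis by (subst counts_le_iff_product[of 2], simp) measurable
qed

lemma (in prob_space) affine_indicator:
  fixes a c :: real
  assumes "S \<in> events"
  shows "integrable M (\<lambda>x. a + c * indicator S x)"
    and "expectation (\<lambda>x. a + c * indicator S x) = a + c * prob S"
proof -
  have int: "integrable M (\<lambda>x. c * indicator S x)"
    using assms by (intro integrable_mult_right integrable_real_indicator) (auto simp: emeasure_eq_measure)
  show "integrable M (\<lambda>x. a + c * indicator S x)"
    using int by (intro Bochner_Integration.integrable_add integrable_const)
  show "expectation (\<lambda>x. a + c * indicator S x) = a + c * prob S"
    using int assms by (subst Bochner_Integration.integral_add) (auto simp: prob_space)
qed

lemma nn_integral_two_valued:
  assumes "prob_space M" "S \<in> sets M" "0 \<le> c"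
  shows "(\<integral>\<^sup>+ x. ennreal (if x \<in> S then c else 1) \<partial>M) = ennreal (1 + (c - 1) * measure M S)"
proof -
  interpret prob_space M by fact
  have "(\<integral>\<^sup>+ x. ennreal (if x \<in> S then c else 1) \<partial>M)
      = (\<integral>\<^sup>+ x. ennreal (1 + (c - 1) * indicator S x) \<partial>M)"
    by (rule nn_integral_cong) (auto simp: indicator_def)
  also have "\<dots> = ennreal (\<integral> x. 1 + (c - 1) * indicator S x \<partial>M)"
  proof (rule nn_integral_eq_integral)
    show "integrable M (\<lambda>x. 1 + (c - 1) * indicator S x)"
      using assms(2) by (rule affine_indicator)
    show "AE x in M. 0 \<le> 1 + (c - 1) * indicator S x"
      using assms(3) by (auto simp: indicator_def)
  qed
  also have "(\<integral> x. 1 + (c - 1) * indicator S x \<partial>M) = 1 + (c - 1) * measure M S"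
    using assms(2) by (rule affine_indicator)
  finally show ?thesis .
qed

text \<open>Markov's inequality is applied to the product weight with threshold 1. Independence
  turns its mean into a product of one-point means, and \<open>1 + x \<le> exp x\<close> bounds each
  factor. Nonnegative integrals avoid integrability obligations.\<close>

lemma prob_counts_le:
  fixes l u :: real and S T :: "real set"
  assumes "l > 0" "u > 1" and [measurable]: "S \<in> sets borel" "T \<in> sets borel"
  defines "U \<equiv> uniform_measure lborel {0..l}"
  shows "measure (instance_space n m l) {p \<in> space (instance_space n m l).
      card {j. j < m \<and> snd p j \<in> T} \<le> card {i. i < n \<and> fst p i \<in> S}}
    \<le> exp (real n * (u - 1) * measure U S - real m * (1 - 1 / u) * measure U T)" (is "measure ?M ?E \<le> _")
proof -
  interpret U: prob_space U
    unfolding U_def using assms(1) by (rule prob_space_uniform_interval)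
  interpret product_sigma_finite "\<lambda>_::nat. U"
    by standard
  interpret R: prob_space "\<Pi>\<^sub>M i\<in>{..<n}. U"
    by (rule prob_space_PiM) (rule U.prob_space_axioms)
  interpret D: prob_space "\<Pi>\<^sub>M j\<in>{..<m}. U"
    by (rule prob_space_PiM) (rule U.prob_space_axioms)
  have M: "?M = (\<Pi>\<^sub>M i\<in>{..<n}. U) \<Otimes>\<^sub>M (\<Pi>\<^sub>M j\<in>{..<m}. U)"
    by (simp add: instance_space_def U_def)
  interpret M: prob_space ?M
    using assms(1) by (rule prob_space_instance_space)
  have [measurable_cong]: "sets U = sets borel" by (simp add: U_def)
  define f where "f x = ennreal (if x \<in> S then u else 1)" for x
  define g where "g y = ennreal (if y \<in> T then 1 / u else 1)" for y
  have [measurable]: "f \<in> borel_measurable U" "g \<in> borel_measurable U"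
    unfolding f_def g_def by measurable
  note [measurable] = coordinate_measurable
  let ?a = "1 + (u - 1) * measure U S" and ?b = "1 + (1 / u - 1) * measure U T"
  \<comment> \<open>The driver factor lies below 1. Its nonnegativity is needed to return from
    \<open>ennreal\<close> to the reals and to compare powers.\<close>
  have b0: "0 \<le> ?b"
  proof -
    have "(1 - 1 / u) * measure U T \<le> 1 * 1"
      using assms(1,2) by (intro mult_mono) (auto simp: field_simps)
    then show ?thesis by (simp add: algebra_simps)
  qed
  \<comment> \<open>The factor \<open>1 *\<close> matches the shape of Markov's inequality used
    next.\<close>
  have "emeasure ?M ?E = emeasure ?M {p \<in> space ?M. 1 \<le> 1 * ((\<Prod>i<n. f (fst p i)) * (\<Prod>j<m. g (snd p j)))}"
  proof -
    have "(\<Prod>i<n. f (fst p i)) * (\<Prod>j<m. g (snd p j)) = ennreal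
        ((\<Prod>i<n. if fst p i \<in> S then u else 1) * (\<Prod>j<m. if snd p j \<in> T then 1 / u else 1))" for p
      using assms(1,2) by (simp add: f_def g_def prod_ennreal prod_nonneg ennreal_mult)
    then show ?thesis
      using assms(2) by (simp add: counts_le_iff_product[of u] ennreal_ge_1)
  qed
  also have "\<dots> \<le> 1 * (\<integral>\<^sup>+ p. ((\<Prod>i<n. f (fst p i)) * (\<Prod>j<m. g (snd p j))) * indicator (space ?M) p \<partial>?M)"
    by (rule nn_integral_Markov_inequality) (auto simp: f_def g_def)
  also have "\<dots> = (\<integral>\<^sup>+ p. (\<Prod>i<n. f (fst p i)) * (\<Prod>j<m. g (snd p j)) \<partial>?M)"
    by (auto intro!: nn_integral_cong)
  also have "\<dots> = (\<integral>\<^sup>+ x. \<integral>\<^sup>+ y. (\<Prod>i<n. f (x i)) * (\<Prod>j<m. g (y j)) \<partial>(\<Pi>\<^sub>M j\<in>{..<m}. U) \<partial>(\<Pi>\<^sub>M i\<in>{..<n}. U))"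
    unfolding M by (subst D.nn_integral_fst[symmetric]) auto
  also have "\<dots> = (\<integral>\<^sup>+ x. (\<Prod>i<n. f (x i)) \<partial>(\<Pi>\<^sub>M i\<in>{..<n}. U)) * (\<integral>\<^sup>+ y. (\<Prod>j<m. g (y j)) \<partial>(\<Pi>\<^sub>M j\<in>{..<m}. U))"
    by (simp add: nn_integral_cmult nn_integral_multc)
  also have "\<dots> = (\<Prod>i<n. integral\<^sup>N U f) * (\<Prod>j<m. integral\<^sup>N U g)"
    by (subst (1 2) product_nn_integral_prod) auto
  also have "\<dots> = ennreal ?a ^ n * ennreal ?b ^ m"
    unfolding f_def g_def using assms(1,2)
    by (simp add: nn_integral_two_valued[OF U.prob_space_axioms])
  also have "\<dots> = ennreal (?a ^ n * ?b ^ m)"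
  proof -
    have "0 \<le> ?a" using \<open>u > 1\<close> by simp
    with b0 show ?thesis
      by (subst (1 2) ennreal_power) (auto simp: ennreal_mult simp del: ennreal_plus)
  qed
  finally have "measure ?M ?E \<le> ?a ^ n * ?b ^ m"
    using b0 assms(1,2) by (simp add: M.emeasure_eq_measure)
  also have "\<dots> \<le> exp ((u - 1) * measure U S) ^ n * exp ((1 / u - 1) * measure U T) ^ m"
    using b0 assms(1,2) by (intro mult_mono power_mono exp_ge_add_one_self) auto
  also have "\<dots> = exp (real n * (u - 1) * measure U S - real m * (1 - 1 / u) * measure U T)"
    by (simp add: exp_of_nat_mult[symmetric] exp_add[symmetric] algebra_simps)
  finally show ?thesis .
qed

text \<open>The closed case is only an upper bound because the widened rider interval may stick out
  of the segment.\<close>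

lemma measure_uniform_interval:
  assumes "l > 0" "a \<le> b"
  shows "measure (uniform_measure lborel {0..l}) {a..b} \<le> (b - a) / l"
    and "0 \<le> a \<Longrightarrow> b \<le> l \<Longrightarrow> measure (uniform_measure lborel {0..l}) {a<..<b} = (b - a) / l"
proof -
  have *: "measure (uniform_measure lborel {0..l}) B = measure lborel ({0..l} \<inter> B) / l"
    if "B \<in> sets borel" for B
    using that assms by (subst measure_uniform_measure) auto
  have "measure lborel ({0..l} \<inter> {a..b}) \<le> measure lborel {a..b}"
    using assms by (intro measure_mono_fmeasurable) (auto simp: fmeasurable_def)
  then show "measure (uniform_measure lborel {0..l}) {a..b} \<le> (b - a) / l"
    using assms by (simp add: * divide_right_mono)
  assume "0 \<le> a" "b \<le> l"
  then have "{0..l} \<inter> {a<..<b} = {a<..<b}" by auto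
  then show "measure (uniform_measure lborel {0..l}) {a<..<b} = (b - a) / l"
    using assms by (simp add: *)
qed

section \<open>Rounding to the grid and union bound\<close>

text \<open>Rounding \<open>a\<close> up and \<open>b\<close> down shrinks the driver interval and
  loses less than one cell at each end, whence \<open>s + 2\<close>. Widening by one cell on each
  side recovers \<open>{a..b}\<close> for the riders. Both changes preserve the inequality of
  counts.\<close>

lemma count_gap_on_grid:
  fixes a b l s :: real and r d :: "nat \<Rightarrow> real"
  assumes "l > 0" "n > 0" "0 \<le> s" "0 \<le> a" "b \<le> l" and long: "b - a > (s + 2) * l / real n"
    and le: "card {j. j < m \<and> d j \<in> {a<..<b}} \<le> card {i. i < n \<and> r i \<in> {a..b}}"
  obtains i k where "i \<le> n" "k \<le> n" "real k - real i \<ge> s"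
    "card {j. j < m \<and> d j \<in> {real i * l / n <..< real k * l / n}}
      \<le> card {j. j < n \<and> r j \<in> {(real i - 1) * l / n..(real k + 1) * l / n}}"
proof -
  define i where "i = nat \<lceil>a * n / l\<rceil>"
  define k where "k = nat \<lfloor>b * n / l\<rfloor>"
  have pos: "0 \<le> a * n / l" using assms by simp
  have "0 \<le> (s + 2) * l / real n" using assms by simp
  then have "0 \<le> b" using long \<open>0 \<le> a\<close> by linarith
  then have pos': "0 \<le> b * n / l" using assms by simp
  have i: "a * n / l \<le> real i" "real i < a * n / l + 1"
    using pos unfolding i_def by linarith+
  have k: "b * n / l < real k + 1" "real k \<le> b * n / l"
    using pos' unfolding k_def by linarith+
  have gap: "b * n / l - a * n / l > s + 2"
    using long assms(1,2) by (simp add: field_simps)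
  then have ki: "real k - real i \<ge> s" using i k by linarith
  have "b * n / l \<le> real n" using assms by (simp add: field_simps mult_left_mono)
  then have "k \<le> n" using k by linarith
  moreover have "i \<le> k" using ki \<open>0 \<le> s\<close> by linarith
  ultimately have "i \<le> n" by simp
  have "a \<le> real i * l / n" "(real i - 1) * l / n \<le> a" "real k * l / n \<le> b" "b \<le> (real k + 1) * l / n"
    using i k assms(1,2) by (simp_all add: field_simps)
  then have "{real i * l / n <..< real k * l / n} \<subseteq> {a<..<b}"
    "{a..b} \<subseteq> {(real i - 1) * l / n..(real k + 1) * l / n}" by auto
  then have "card {j. j < m \<and> d j \<in> {real i * l / n <..< real k * l / n}} \<le> card {j. j < m \<and> d j \<in> {a<..<b}}"
    "card {i. i < n \<and> r i \<in> {a..b}} \<le> card {j. j < n \<and> r j \<in> {(real i - 1) * l / n..(real k + 1) * l / n}}"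
    by (auto intro!: card_mono)
  then show ?thesis using that[OF \<open>i \<le> n\<close> \<open>k \<le> n\<close> ki] le by simp
qed

text \<open>
  Riders are counted in an interval wider by one cell on each side, so that these grid events cover
  every gap with real endpoints.
\<close>

definition overfull :: "nat \<Rightarrow> nat \<Rightarrow> real \<Rightarrow> nat \<Rightarrow> nat \<Rightarrow> positions set" where
  "overfull n m l i k = {p \<in> space (instance_space n m l).
     card {j. j < m \<and> snd p j \<in> {real i * l / n <..< real k * l / n}}
      \<le> card {j. j < n \<and> fst p j \<in> {(real i - 1) * l / n..(real k + 1) * l / n}}}"

definition overfull_long :: "nat \<Rightarrow> nat \<Rightarrow> real \<Rightarrow> real \<Rightarrow> positions set" where
  "overfull_long n m l s =
     (\<Union>(i, k) \<in> {(i, k) \<in> {..n} \<times> {..n}. s \<le> real k - real i}. overfull n m l i k)"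

lemma overfull_sets: "overfull n m l i k \<in> sets (instance_space n m l)"
  unfolding overfull_def by (rule counts_le_sets) auto

lemma overfull_long_sets: "overfull_long n m l s \<in> sets (instance_space n m l)"
proof -
  have "finite {(i, k) \<in> {..n} \<times> {..n}. s \<le> real k - real i}"
    by (rule finite_subset[of _ "{..n} \<times> {..n}"]) auto
  then show ?thesis
    unfolding overfull_long_def by (rule sets.finite_UN) (auto simp: overfull_sets)
qed

text \<open>With \<open>L = k - i\<close> cells, the mean number of riders is at most
  \<open>L + 2\<close> and that of drivers at least \<open>u\<^sup>2 * L\<close>. The Chernoff
  exponent is then at most \<open>(u - 1) * (L + 2) - u * (u - 1) * L\<close>.\<close>

lemma measure_overfull:
  fixes u l :: real
  assumes "l > 0" "u > 1" "real m \<ge> u\<^sup>2 * real n" "i \<le> k" "k \<le> n" "n > 0"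
  shows "measure (instance_space n m l) (overfull n m l i k)
    \<le> exp (2 * (u - 1) - (u - 1)\<^sup>2 * (real k - real i))"
proof -
  define U where "U = uniform_measure lborel {0..l}"
  have "measure U {(real i - 1) * l / n..(real k + 1) * l / n}
      \<le> ((real k + 1) * l / n - (real i - 1) * l / n) / l"
    unfolding U_def using assms
    by (intro measure_uniform_interval divide_right_mono mult_right_mono) auto
  also have "\<dots> = (real k - real i + 2) / n"
    using assms by (simp add: field_simps)
  finally have R: "measure U {(real i - 1) * l / n..(real k + 1) * l / n} \<le> (real k - real i + 2) / n" .
  have "measure U {real i * l / n <..< real k * l / n} = (real k * l / n - real i * l / n) / l"
    unfolding U_def using assms
    by (intro measure_uniform_interval divide_right_mono mult_right_mono) (auto simp: field_simps)
  also have "\<dots> = (real k - real i) / n"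
    using assms by (simp add: field_simps)
  finally have D: "measure U {real i * l / n <..< real k * l / n} = (real k - real i) / n" .
  have "real n * (u - 1) * measure U {(real i - 1) * l / n..(real k + 1) * l / n}
      \<le> real n * (u - 1) * ((real k - real i + 2) / n)"
    using R assms by (intro mult_left_mono) auto
  also have "\<dots> = (u - 1) * (real k - real i + 2)"
    using assms by simp
  finally have 1: "real n * (u - 1) * measure U {(real i - 1) * l / n..(real k + 1) * l / n}
      \<le> (u - 1) * (real k - real i + 2)" .
  have "u * (u - 1) * (real k - real i) = (u\<^sup>2 * real n) * (1 - 1 / u) * ((real k - real i) / n)"
    using assms by (simp add: field_simps power2_eq_square)
  also have "\<dots> \<le> real m * (1 - 1 / u) * ((real k - real i) / n)"
    using assms by (intro mult_right_mono) auto
  finally have 2: "u * (u - 1) * (real k - real i)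
      \<le> real m * (1 - 1 / u) * measure U {real i * l / n <..< real k * l / n}"
    by (simp add: D)
  have "(u - 1) * (real k - real i + 2) - u * (u - 1) * (real k - real i)
      = 2 * (u - 1) - (u - 1)\<^sup>2 * (real k - real i)"
    by (simp add: algebra_simps power2_eq_square)
  with 1 2 have "real n * (u - 1) * measure U {(real i - 1) * l / n..(real k + 1) * l / n}
      - real m * (1 - 1 / u) * measure U {real i * l / n <..< real k * l / n}
      \<le> 2 * (u - 1) - (u - 1)\<^sup>2 * (real k - real i)"
    by linarith
  then show ?thesis
    unfolding overfull_def U_def using assms(1,2)
    by (intro order_trans[OF prob_counts_le]) auto
qed

text \<open>The constant 3 makes each event have probability of order \<open>1 / n ^ 3\<close>. The
  union bound over at most \<open>(n + 1)\<^sup>2\<close> pairs costs two of these powers and leaves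
  \<open>1 / n\<close>.\<close>

lemma measure_overfull_long:
  fixes u l :: real
  assumes "l > 0" "u > 1" "real m \<ge> u\<^sup>2 * real n" "n > 0"
  shows "measure (instance_space n m l) (overfull_long n m l (3 / (u - 1)\<^sup>2 * ln n))
    \<le> 4 * exp (2 * (u - 1)) / n"
proof -
  define s where "s = 3 / (u - 1)\<^sup>2 * ln n"
  let ?I = "{(i, k) \<in> {..n} \<times> {..n}. s \<le> real k - real i}"
  have s0: "0 \<le> s" using assms by (simp add: s_def)
  have fin: "finite ?I" by (rule finite_subset[of _ "{..n} \<times> {..n}"]) auto
  have each: "measure (instance_space n m l) (overfull n m l i k) \<le> exp (2 * (u - 1)) / real n ^ 3"
    if "(i, k) \<in> ?I" for i k
  proof -
    have ki: "i \<le> k" "k \<le> n" "s \<le> real k - real i" using that s0 by auto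
    have "3 * ln n = (u - 1)\<^sup>2 * s" using assms by (simp add: s_def)
    also have "\<dots> \<le> (u - 1)\<^sup>2 * (real k - real i)" using ki by (intro mult_left_mono) auto
    finally have "exp (2 * (u - 1) - (u - 1)\<^sup>2 * (real k - real i)) \<le> exp (2 * (u - 1) - 3 * ln n)"
      by simp
    also have "\<dots> = exp (2 * (u - 1)) / real n ^ 3"
      using assms exp_of_nat_mult[of 3 "ln (real n)"] by (simp add: exp_diff)
    finally show ?thesis
      using measure_overfull[OF assms(1-3) ki(1,2) assms(4)] by linarith
  qed
  have "measure (instance_space n m l) (overfull_long n m l s)
      \<le> (\<Sum>(i, k)\<in>?I. measure (instance_space n m l) (overfull n m l i k))"
    unfolding overfull_long_def
    using measure_UNION_le[OF fin, of "\<lambda>(i, k). overfull n m l i k" "instance_space n m l"]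
    by (auto simp: overfull_sets case_prod_unfold)
  also have "\<dots> \<le> (\<Sum>(i, k)\<in>?I. exp (2 * (u - 1)) / real n ^ 3)"
    using each by (intro sum_mono) auto
  also have "\<dots> = real (card ?I) * (exp (2 * (u - 1)) / real n ^ 3)"
    by (simp add: case_prod_unfold)
  also have "\<dots> \<le> (4 * real n ^ 2) * (exp (2 * (u - 1)) / real n ^ 3)"
  proof (rule mult_right_mono)
    have "card ?I \<le> card ({..n} \<times> {..n})" by (rule card_mono) auto
    also have "\<dots> = (n + 1) ^ 2" by (simp add: power2_eq_square)
    also have "\<dots> \<le> (2 * n) ^ 2" using assms by (intro power_mono) auto
    finally show "real (card ?I) \<le> 4 * real n ^ 2"
      using of_nat_mono[of "card ?I" "(2 * n)\<^sup>2", where ?'a = real] by (simp add: power_mult_distrib)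
  qed auto
  also have "\<dots> = 4 * exp (2 * (u - 1)) / n"
    using assms by (simp add: field_simps power2_eq_square power3_eq_cube)
  finally show ?thesis by (simp add: s_def)
qed

section \<open>From short gaps to the expected cost\<close>

text \<open>The claim is pathwise, so the order chosen by the adversary is irrelevant. The induction
  over time applies the gap lemma to the state just before each match; a longer gap would round to a
  grid pair that puts \<open>p\<close> in \<open>overfull_long\<close>.\<close>

lemma greedy_match_dist_le:
  assumes A: "valid_adversary n m l A" and p: "p \<in> space (instance_space n m l)" "p \<notin> overfull_long n m l s"
    and r: "\<And>i. i < n \<Longrightarrow> fst p i \<in> {0..l}" and d: "\<And>j. j < m \<Longrightarrow> snd p j \<in> {0..l}"
    and "l > 0" "n \<le> m" "0 \<le> s" "k \<le> n" "(i, j) \<in> set (greedy_run m A p k)"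
  shows "\<bar>fst p i - snd p j\<bar> \<le> (s + 2) * l / n"
  using \<open>k \<le> n\<close> \<open>(i, j) \<in> set (greedy_run m A p k)\<close>
proof (induction k)
  case 0
  then show ?case by simp
next
  case (Suc k)
  let ?h = "greedy_run m A p k"
  let ?i = "A p ?h"
  let ?j = "closest_unmatched m (snd p) ?h (fst p ?i)"
  show ?case
  proof (cases "(i, j) \<in> set ?h")
    case True
    then show ?thesis using Suc by simp
  next
    case False
    then have ij: "i = ?i" "j = ?j" using Suc.prems by (auto simp: Let_def)
    have "?i \<in> unrevealed n ?h"
      using A p Suc.prems unrevealed_nonempty[of ?h n]
      by (auto simp: valid_adversary_def length_greedy_run)
    then have x: "fst p ?i \<in> {0..l}" by (intro r) (simp add: unrevealed_def)
    have ne: "unmatched m ?h \<noteq> {}"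
      using unmatched_nonempty[of ?h m] \<open>n \<le> m\<close> Suc.prems by (simp add: length_greedy_run)
    have h: "greedy_matching n m p ?h"
      using greedy_matching_greedy_run[OF A p(1) \<open>n \<le> m\<close>] Suc.prems by simp
    obtain a b where ab: "0 \<le> a" "a \<le> b" "b \<le> l" "\<bar>fst p ?i - snd p ?j\<bar> \<le> b - a"
      and le: "card {j. j < m \<and> snd p j \<in> {a<..<b}} \<le> card {i. i < n \<and> fst p i \<in> {a..b}}"
      by (rule gap_around_point[OF h ne r d x])
    have "b - a \<le> (s + 2) * l / n"
    proof (rule ccontr)
      assume "\<not> b - a \<le> (s + 2) * l / n"
      then have long: "b - a > (s + 2) * l / n" by simp
      have "n > 0" using Suc.prems by simp
      obtain i' k' where "i' \<le> n" "k' \<le> n" "real k' - real i' \<ge> s"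
        "card {j. j < m \<and> snd p j \<in> {real i' * l / n <..< real k' * l / n}}
          \<le> card {j. j < n \<and> fst p j \<in> {(real i' - 1) * l / n..(real k' + 1) * l / n}}"
        by (rule count_gap_on_grid[OF \<open>l > 0\<close> \<open>n > 0\<close> \<open>0 \<le> s\<close> ab(1,3) long le])
      then have "p \<in> overfull_long n m l s"
        using p(1) unfolding overfull_long_def overfull_def by blast
      then show False using p(2) by simp
    qed
    then show ?thesis using ab ij by simp
  qed
qed

lemma greedy_cost_le:
  assumes "\<And>i j. (i, j) \<in> set (greedy_run m A p n) \<Longrightarrow> \<bar>fst p i - snd p j\<bar> \<le> w"
  shows "greedy_cost n m A p \<le> real n * w"
proof -
  have "(\<Sum>(i, j)\<leftarrow>h. \<bar>fst p i - snd p j\<bar>) \<le> real (length h) * w"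
    if "\<forall>(i, j) \<in> set h. \<bar>fst p i - snd p j\<bar> \<le> w" for h
    using that by (induction h) (auto simp: algebra_simps)
  then show ?thesis
    using assms by (force simp: greedy_cost_def length_greedy_run)
qed

lemma greedy_cost_nonneg: "0 \<le> greedy_cost n m A p"
  unfolding greedy_cost_def by (rule sum_list_nonneg) auto

lemma expected_greedy_cost_le:
  fixes u l :: real
  assumes A: "valid_adversary n m l A" and "l > 0" "u > 1" "real m \<ge> u\<^sup>2 * real n" "n > 0"
  shows "integrable (instance_space n m l) (greedy_cost n m A)"
    and "(\<integral>p. greedy_cost n m A p \<partial>instance_space n m l)
      \<le> l * (3 / (u - 1)\<^sup>2 * ln n + 2 + 4 * exp (2 * (u - 1)))"
proof -
  let ?M = "instance_space n m l"
  interpret prob_space ?M using \<open>l > 0\<close> by (rule prob_space_instance_space)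
  define s where "s = 3 / (u - 1)\<^sup>2 * ln n"
  define B where "B = overfull_long n m l s"
  have s0: "0 \<le> s" using assms by (simp add: s_def)
  have "1 * real n \<le> u\<^sup>2 * real n" using \<open>u > 1\<close> by (intro mult_right_mono) auto
  then have "real n \<le> real m" using assms(4) by simp
  then have nm: "n \<le> m" by simp
  have [measurable]: "B \<in> sets ?M" unfolding B_def by (rule overfull_long_sets)
  \<comment> \<open>The crude bound \<open>n * l\<close> serves twice: it gives integrability, and
    it controls the cost on the exceptional event \<open>B\<close>.\<close>
  have bound: "AE p in ?M. greedy_cost n m A p \<le> (s + 2) * l + real n * l * indicator B p
      \<and> greedy_cost n m A p \<le> real n * l"
    using AE_instance_space[OF \<open>l > 0\<close>, of n m] AE_space
  proof eventually_elim
    case (elim p)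
    have "\<bar>fst p i - snd p j\<bar> \<le> l" if "(i, j) \<in> set (greedy_run m A p n)" for i j
    proof -
      have "i < n" "j < m"
        using that greedy_matching_greedy_run[OF A elim(2) nm order_refl] by (auto simp: greedy_matching_def)
      then show ?thesis using elim by (auto simp: abs_le_iff) (smt (verit))+
    qed
    then have trivial: "greedy_cost n m A p \<le> real n * l" by (rule greedy_cost_le)
    moreover have "greedy_cost n m A p \<le> (s + 2) * l + real n * l * indicator B p"
    proof (cases "p \<in> B")
      case True
      have "0 \<le> (s + 2) * l" using s0 \<open>l > 0\<close> by simp
      then show ?thesis using trivial True by simp
    next
      case False
      have "greedy_cost n m A p \<le> real n * ((s + 2) * l / n)"
        using elim False nm s0 \<open>l > 0\<close> unfolding B_def
        by (intro greedy_cost_le greedy_match_dist_le[OF A, where k = n]) auto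
      then show ?thesis using False \<open>n > 0\<close> by simp
    qed
    ultimately show ?case by simp
  qed
  show int: "integrable ?M (greedy_cost n m A)"
  proof (rule integrable_const_bound)
    show "AE p in ?M. norm (greedy_cost n m A p) \<le> real n * l"
      using bound by eventually_elim (simp add: greedy_cost_nonneg)
  qed (rule greedy_cost_measurable[OF A])
  have "(\<integral>p. greedy_cost n m A p \<partial>?M) \<le> (\<integral>p. (s + 2) * l + real n * l * indicator B p \<partial>?M)"
  proof (rule integral_mono_AE[OF int])
    show "AE p in ?M. greedy_cost n m A p \<le> (s + 2) * l + real n * l * indicator B p"
      using bound by eventually_elim simp
  qed (simp add: affine_indicator)
  also have "\<dots> = (s + 2) * l + real n * l * measure ?M B"
    by (simp add: affine_indicator)
  also have "\<dots> \<le> (s + 2) * l + real n * l * (4 * exp (2 * (u - 1)) / n)"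
    unfolding B_def s_def using assms
    by (intro add_left_mono mult_left_mono measure_overfull_long) auto
  also have "\<dots> = l * (3 / (u - 1)\<^sup>2 * ln n + 2 + 4 * exp (2 * (u - 1)))"
    using \<open>n > 0\<close> by (simp add: s_def algebra_simps)
  finally show "(\<integral>p. greedy_cost n m A p \<partial>?M) \<le> l * (3 / (u - 1)\<^sup>2 * ln n + 2 + 4 * exp (2 * (u - 1)))" .
qed

theorem theorem2:
  fixes \<epsilon> :: real
  assumes "\<epsilon> > 0"
  shows "\<exists>C > 0. \<exists>n\<^sub>0 :: nat. \<forall>n \<ge> n\<^sub>0. \<forall>m :: nat. \<forall>l :: real. \<forall>A.
           real m \<ge> (1 + \<epsilon>) * real n \<longrightarrow> l > 0 \<longrightarrow> valid_adversary n m l A \<longrightarrow>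
           integrable (instance_space n m l) (greedy_cost n m A) \<and>
           (\<integral>p. greedy_cost n m A p \<partial>instance_space n m l) \<le> C * l * ln (real n) ^ 3"
proof -
  \<comment> \<open>For a driver to rider ratio of \<open>1 + \<epsilon>\<close>, this base
    minimises the Chernoff exponent per cell,
    \<open>(u - 1) - (1 + \<epsilon>) * (1 - 1 / u)\<close>, whose minimum is
    \<open>- (u - 1)\<^sup>2\<close>.\<close>
  define u where "u = sqrt (1 + \<epsilon>)"
  have u: "u > 1" "u\<^sup>2 = 1 + \<epsilon>" using assms by (auto simp: u_def)
  define C where "C = 3 / (u - 1)\<^sup>2 + 2 + 4 * exp (2 * (u - 1))"
  have nonneg: "0 \<le> 3 / (u - 1)\<^sup>2" "0 < 4 * exp (2 * (u - 1))" by simp_all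
  then have "C > 0" unfolding C_def by linarith
  moreover have "integrable (instance_space n m l) (greedy_cost n m A) \<and>
      (\<integral>p. greedy_cost n m A p \<partial>instance_space n m l) \<le> C * l * ln (real n) ^ 3"
    if "n \<ge> 3" "real m \<ge> (1 + \<epsilon>) * real n" "l > 0" "valid_adversary n m l A" for n m l A
  proof -
    have m: "real m \<ge> u\<^sup>2 * real n" and n: "n > 0" using that u by simp_all
    note E = expected_greedy_cost_le[OF that(4) that(3) u(1) m n]
    \<comment> \<open>The threshold 3 is chosen because \<open>exp 1 \<le> 3\<close>. Once the
      logarithm is at least 1, its cube absorbs both the linear term and the constants.\<close>
    have "1 \<le> ln (real n)"
      using that(1) exp_le by (subst ln_ge_iff) (auto intro: order_trans)
    then have ln3: "ln (real n) \<le> ln (real n) ^ 3" "1 \<le> ln (real n) ^ 3"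
      using power_increasing[of 1 3 "ln (real n)"] one_le_power[of "ln (real n)" 3] by auto
    have "3 / (u - 1)\<^sup>2 * ln n + (2 + 4 * exp (2 * (u - 1))) * 1
        \<le> 3 / (u - 1)\<^sup>2 * ln n ^ 3 + (2 + 4 * exp (2 * (u - 1))) * ln n ^ 3"
      using ln3 by (intro add_mono mult_left_mono) auto
    also have "\<dots> = C * ln n ^ 3" by (simp add: C_def algebra_simps)
    finally have "l * (3 / (u - 1)\<^sup>2 * ln n + 2 + 4 * exp (2 * (u - 1))) \<le> l * (C * ln n ^ 3)"
      using \<open>l > 0\<close> by (intro mult_left_mono) auto
    then show ?thesis using E by (simp add: algebra_simps)
  qed
  ultimately show ?thesis by blast
qed

end
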